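(* Let $0<\varepsilon<1$ and $0<\delta\leq 1$. Let $\mathcal{W}=\{W_1,W_2,\dots\}$ be a $(1-\varepsilon)$-full separating system in which each $W_k$ is $(A_k,B_k)$-bipartite and satisfies $\|W_k\|_{\infty}\leq\delta$. Then $$\sum_{k=1}^{|\mathcal{W}|} m(A_k\cup B_k)\geq \max\left\{\frac{2(1-\varepsilon)}{\delta},\enspace \log\frac{1}{\varepsilon}+\left\lfloor\frac{1-\delta}{2\delta}\right\rfloor\log\left(\delta\log\frac{1}{\varepsilon}\right)-\frac{1}{\delta}-1\right\}.$$
   Context: All logarithms are to base $2$ and $m$ denotes Lebesgue measure. A graphon is a symmetric measurable function $W:[0,1]^2\to[0,1]$, and $\|W\|_{\infty}=\inf\{\alpha\in[0,1]: m(\{(x,y): W(x,y)>\alpha\})=0\}$. For measurable $A,B\subseteq[0,1]$, a graphon $W$ is $(A,B)$-bipartite if $m(A\cap B)=0$ and $m\big(\mathrm{supp}(W)\setminus((A\times B)\cup(B\times A))\big)=0$; $W$ is bipartite if it is $(A,B)$-bipartite for some such $A,B$. A separating system is a countable (finite or infinite) collection $\mathcal{W}$ of bipartite graphons, identified with a sequence $W_1,W_2,\dots$. Define $\mathcal{W}^{\Sigma}(x,y)=\min\{1,\sum_{W\in\mathcal{W}}W(x,y)\}$; $\mathcal{W}$ is $\eta$-full if $\int_{[0,1]^2}\mathcal{W}^{\Sigma}(x,y)\,dx\,dy\geq\eta$. *)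

theory Defs
  imports "HOL-Analysis.Analysis" "HOL-Library.Extended_Nat"
begin

abbreviation unit_square :: "(real \<times> real) set" where
  "unit_square \<equiv> {0..1} \<times> {0..1}"

text \<open>Graphons are represented by functions on all of the plane; only their values on the
  unit square matter, and every notion below looks at those values only.\<close>

definition graphon :: "(real \<Rightarrow> real \<Rightarrow> real) \<Rightarrow> bool" where
  "graphon W \<longleftrightarrow>
     (\<lambda>(x, y). W x y) \<in> borel_measurable (lebesgue_on unit_square) \<and>
     (\<forall>x\<in>{0..1}. \<forall>y\<in>{0..1}. W x y = W y x \<and> 0 \<le> W x y \<and> W x y \<le> 1)"

definition graphon_supnorm :: "(real \<Rightarrow> real \<Rightarrow> real) \<Rightarrow> real" where
  "graphon_supnorm W =
     Inf {\<alpha> \<in> {0..1}. {(x, y) \<in> unit_square. W x y > \<alpha>} \<in> null_sets lebesgue}"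

definition graphon_supp :: "(real \<Rightarrow> real \<Rightarrow> real) \<Rightarrow> (real \<times> real) set" where
  "graphon_supp W = {(x, y) \<in> unit_square. W x y \<noteq> 0}"

definition bipartite_wrt :: "real set \<Rightarrow> real set \<Rightarrow> (real \<Rightarrow> real \<Rightarrow> real) \<Rightarrow> bool" where
  "bipartite_wrt A B W \<longleftrightarrow>
     graphon W \<and>
     A \<in> sets lebesgue \<and> A \<subseteq> {0..1} \<and> B \<in> sets lebesgue \<and> B \<subseteq> {0..1} \<and>
     A \<inter> B \<in> null_sets lebesgue \<and>
     graphon_supp W - (A \<times> B \<union> B \<times> A) \<in> null_sets lebesgue"

definition bipartite :: "(real \<Rightarrow> real \<Rightarrow> real) \<Rightarrow> bool" where
  "bipartite W \<longleftrightarrow> (\<exists>A B. bipartite_wrt A B W)"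

text \<open>A finite or infinite sequence \<open>W\<^sub>1, W\<^sub>2, \<dots>\<close> is a length \<open>N :: enat\<close> together with a
  function on \<open>nat\<close>, of which only the values at the indices below are relevant.\<close>

definition indices :: "enat \<Rightarrow> nat set" where
  "indices N = {k. 1 \<le> k \<and> enat k \<le> N}"

definition separating_system :: "enat \<Rightarrow> (nat \<Rightarrow> real \<Rightarrow> real \<Rightarrow> real) \<Rightarrow> bool" where
  "separating_system N W \<longleftrightarrow> (\<forall>k\<in>indices N. bipartite (W k))"

text \<open>The pointwise sum may diverge, so it is taken in \<open>ennreal\<close>, where every sum exists.\<close>

definition system_sum :: "enat \<Rightarrow> (nat \<Rightarrow> real \<Rightarrow> real \<Rightarrow> real) \<Rightarrow> real \<Rightarrow> real \<Rightarrow> real" where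
  "system_sum N W x y = enn2real (min 1 (\<Sum>\<^sub>\<infinity>k\<in>indices N. ennreal (W k x y)))"

definition full :: "real \<Rightarrow> enat \<Rightarrow> (nat \<Rightarrow> real \<Rightarrow> real \<Rightarrow> real) \<Rightarrow> bool" where
  "full \<eta> N W \<longleftrightarrow>
     integral\<^sup>L (lebesgue_on unit_square) (\<lambda>(x, y). system_sum N W x y) \<ge> \<eta>"

end

theory Submission
  imports Defs "HOL-Probability.Probability_Measure"
begin

text \<open>
  Put \<open>s = \<Sum>\<^sub>k m (A\<^sub>k \<union> B\<^sub>k)\<close> and let \<open>d(x)\<close> be the number of \<open>k\<close> with \<open>x \<in> A\<^sub>k \<union> B\<^sub>k\<close>, so that
  \<open>\<integral>d = s\<close>. The first bound is \<open>\<integral>W\<^sub>k \<le> 2 \<delta> m(A\<^sub>k) m(B\<^sub>k) \<le> (\<delta>/2) m(A\<^sub>k \<union> B\<^sub>k)\<close>.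

  For the second bound, choose at random for each \<open>k\<close> one of the two sides, and let a point survive
  if it lies on the wrong side for at most \<open>r = \<lfloor>(1 - \<delta>)/(2\<delta>)\<rfloor>\<close> of the \<open>k\<close>. Two survivors are
  separated at most \<open>2r\<close> times, so such a pair misses at least \<open>1 - 2r\<delta> \<ge> \<delta>\<close> of the full weight. A point
  survives with probability \<open>p(x) = 2\<^sup>-\<^sup>d C(d, \<le>r)\<close>. Weighting points by \<open>p(x)\<close> to the power \<open>-1/2\<close> and
  applying Cauchy-Schwarz over the random choice bounds the measure of the pairs separated at most
  \<open>2r\<close> times from below by \<open>(\<integral> sqrt p)\<^sup>2\<close>, because two points survive together with probability at
  most \<open>sqrt (p(x) p(y))\<close>. A tangent estimate then gives \<open>\<epsilon> \<ge> (1 - 2r\<delta>) 2\<^sup>-\<^sup>s a\<^sup>r\<close> with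
  \<open>a = \<delta> log (1/\<epsilon>)\<close>, provided \<open>a \<ge> 4\<close>. The case \<open>r = 0\<close> of the same argument gives
  \<open>s \<ge> log (1/\<epsilon>)\<close>, which suffices if \<open>a < 4\<close>.
\<close>

section \<open>Tangent estimate for the proportion of a Hamming ball\<close>

lemma two_powr_ge: "1 + t * ln 2 \<le> (2::real) powr t"
  using exp_ge_add_one_self[of "t * ln 2"] by (simp add: powr_def)

text \<open>For \<open>1 \<le> r \<le> d\<close> the single term \<open>d choose r\<close> suffices,
  being at least \<open>(d / r) ^ r\<close> with \<open>a \<le> d / r\<close>. For
  \<open>d < r\<close> the hypothesis forces \<open>a \<le> 1\<close>, and the term at 0
  suffices.\<close>

lemma sum_binomial_ge_power:
  fixes a :: real
  assumes "0 < a" "a * real r \<le> real d"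
  shows "a ^ r \<le> (\<Sum>i\<le>r. real (d choose i))"
proof (cases "r = 0 \<or> d < r")
  case False
  have "a ^ r \<le> (real d / real r) ^ r"
    using assms False by (intro power_mono) (auto simp: field_simps)
  also have "\<dots> \<le> real (d choose r)"
    using False binomial_ge_n_over_k_pow_k[of r d, where 'a = real] by auto
  also have "\<dots> \<le> (\<Sum>i\<le>r. real (d choose i))"
    by (rule member_le_sum) auto
  finally show ?thesis .
next
  case True
  show ?thesis
  proof (cases "r = 0")
    case False
    then have "d < r" using True by simp
    have "a \<le> 1"
    proof (rule ccontr)
      assume "\<not> a \<le> 1"
      then have "1 * real r \<le> a * real r" by (intro mult_right_mono) auto
      then show False using assms \<open>d < r\<close> by linarith
    qed
    then have "a ^ r \<le> 1" using assms by (simp add: power_le_one)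
    also have "\<dots> \<le> real (d choose 0)" by simp
    also have "\<dots> \<le> (\<Sum>i\<le>r. real (d choose i))"
      by (rule member_le_sum) auto
    finally show ?thesis .
  qed auto
qed

text \<open>The right-hand side is the tangent at \<open>s\<close> of \<open>d \<mapsto> sqrt (a ^ r / 2 powr d)\<close>. A tangent is used
  because the left-hand side is not a convex function of \<open>d\<close>, so that Jensen's inequality does not
  apply to it directly.\<close>

lemma sqrt_hamming_ball_ge_tangent:
  fixes a s :: real and d r :: nat
  assumes "0 < a" and r: "r = 0 \<or> 4 \<le> a \<and> a * (2 * real r + 1) \<le> s"
  shows "2 powr (-s/2) * a powr (real r / 2) * (1 + (s - real d) / 2 * ln 2)
         \<le> sqrt ((\<Sum>i\<le>r. real (d choose i)) / 2 ^ d)"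
proof (cases "a * real r \<le> real d")
  case True
  have "2 powr (-s/2) * a powr (real r / 2) * (1 + (s - real d) / 2 * ln 2)
      \<le> 2 powr (-s/2) * a powr (real r / 2) * 2 powr ((s - real d) / 2)"
    by (intro mult_left_mono two_powr_ge) auto
  also have "\<dots> = a powr (real r / 2) * (2 powr (-s/2) * 2 powr ((s - real d) / 2))" by simp
  also have "2 powr (-s/2) * 2 powr ((s - real d) / 2) = (2::real) powr (- real d / 2)"
    by (subst powr_add[symmetric]) (simp add: field_simps)
  also have "a powr (real r / 2) * 2 powr (- real d / 2) = sqrt (a ^ r / 2 ^ d)"
    using \<open>0 < a\<close>
    by (simp add: powr_half_sqrt_powr powr_minus real_sqrt_divide powr_realpow divide_simps)
  also have "\<dots> \<le> sqrt ((\<Sum>i\<le>r. real (d choose i)) / 2 ^ d)"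
    using sum_binomial_ge_power[OF \<open>0 < a\<close> True] by (simp add: divide_right_mono)
  finally show ?thesis .
next
  case False
  then have "r \<noteq> 0" by (metis mult_zero_right of_nat_0 of_nat_0_le_iff)
  with r have a: "4 \<le> a" and s: "a * (2 * real r + 1) \<le> s" by auto
  \<comment> \<open>With \<open>d < a * r\<close> only the term 1 of the ball is used. The gap
    \<open>u\<close> is then so large that the tangent stays below
    \<open>2 powr (- d / 2)\<close>.\<close>
  define u where "u = s - real d"
  have u: "a * real r \<le> u - 4"
    using s a False by (simp add: u_def algebra_simps)
  \<comment> \<open>Equality holds at \<open>a = 4\<close>, and beyond it the right-hand side has
    slope at least \<open>2 * ln 2\<close>, which exceeds 1.\<close>
  have "a \<le> 2 powr (a / 2)"
  proof -
    have "1 / 2 \<le> ln (2::real)" using ln2_ge_two_thirds by simp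
    then have "(a - 4) / 2 * (1/2) \<le> (a - 4) / 2 * ln 2"
      using a by (intro mult_left_mono) auto
    then have "a \<le> 4 * (1 + (a - 4) / 2 * ln 2)" by (simp add: field_simps)
    also have "\<dots> \<le> 4 * 2 powr ((a - 4) / 2)"
      by (intro mult_left_mono two_powr_ge) auto
    also have "\<dots> = 2 powr 2 * 2 powr ((a - 4) / 2)" by simp
    also have "\<dots> = 2 powr (a / 2)"
      by (subst powr_add[symmetric]) (simp add: field_simps)
    finally show ?thesis .
  qed
  then have "a powr (real r / 2) \<le> (2 powr (a / 2)) powr (real r / 2)"
    using a by (intro powr_mono2) auto
  also have "\<dots> = 2 powr (a * real r / 4)" by (simp add: powr_powr)
  also have "\<dots> \<le> 2 powr ((u - 4) / 4)" using u by simp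
  finally have *: "a powr (real r / 2) \<le> 2 powr ((u - 4) / 4)" .
  have "0 \<le> u" using u a by (smt (verit) mult_nonneg_nonneg of_nat_0_le_iff)
  \<comment> \<open>The linear bound is taken at \<open>u / 4\<close> and loses a factor 2, which
    the \<open>- 4\<close> in \<open>2 powr ((u - 4) / 4)\<close> pays for.\<close>
  have "1 + u / 2 * ln 2 \<le> 2 * (1 + u / 4 * ln 2)" by simp
  also have "\<dots> \<le> 2 * 2 powr (u / 4)" by (intro mult_left_mono two_powr_ge) auto
  also have "\<dots> = 2 powr (1 + u / 4)" by (subst powr_add) simp
  finally have "a powr (real r / 2) * (1 + u / 2 * ln 2) \<le> 2 powr ((u - 4) / 4) * 2 powr (1 + u / 4)"
    using * \<open>0 \<le> u\<close> by (intro mult_mono) auto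
  also have "\<dots> = 2 powr (u / 2)" by (subst powr_add[symmetric]) (simp add: field_simps)
  finally have "2 powr (-s/2) * (a powr (real r / 2) * (1 + u / 2 * ln 2)) \<le> 2 powr (-s/2) * 2 powr (u / 2)"
    by (rule mult_left_mono) auto
  also have "\<dots> = (2::real) powr (- real d / 2)"
    by (subst powr_add[symmetric]) (simp add: field_simps u_def)
  also have "\<dots> = sqrt (1 / 2 ^ d)"
    by (simp add: powr_half_sqrt_powr powr_minus real_sqrt_divide powr_realpow divide_simps)
  also have "\<dots> \<le> sqrt ((\<Sum>i\<le>r. real (d choose i)) / 2 ^ d)"
    using member_le_sum[of 0 "{..r}" "\<lambda>i. real (d choose i)"] by (simp add: divide_right_mono)
  finally show ?thesis by (simp add: u_def mult.assoc)
qed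

section \<open>Random choice of sides and Cauchy-Schwarz\<close>

text \<open>Here \<open>X\<close> and \<open>Y\<close> are the indices having a given point on their
  first and second side, and \<open>k \<in> z\<close> declares the first side right. The error set
  \<open>z \<inter> Y \<union> (X - z)\<close> can be any subset of \<open>X \<union> Y\<close> and
  determines \<open>z\<close> there; elsewhere \<open>z\<close> is free, which gives the power of
  2.\<close>

lemma card_few_errors:
  assumes "finite I" "X \<union> Y \<subseteq> I" "X \<inter> Y = {}"
  shows "card {z \<in> Pow I. card (z \<inter> Y \<union> (X - z)) \<le> r}
       = 2 ^ (card I - card (X \<union> Y)) * (\<Sum>i\<le>r. card (X \<union> Y) choose i)"
proof -
  let ?D = "X \<union> Y"
  have fD: "finite ?D" using assms finite_subset by blast
  let ?L = "{z \<in> Pow I. card (z \<inter> Y \<union> (X - z)) \<le> r}"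
  let ?R = "{u \<in> Pow ?D. card u \<le> r} \<times> Pow (I - ?D)"
  have "bij_betw (\<lambda>z. (z \<inter> Y \<union> (X - z), z - ?D)) ?L ?R"
  proof (rule bij_betw_byWitness[where f' = "\<lambda>(u, v). (u \<inter> Y) \<union> (X - u) \<union> v"])
    show "\<forall>z\<in>?L. (\<lambda>(u, v). (u \<inter> Y) \<union> (X - u) \<union> v) (z \<inter> Y \<union> (X - z), z - ?D) = z"
      using assms by auto
    show inv: "\<forall>p\<in>?R. (\<lambda>z. (z \<inter> Y \<union> (X - z), z - ?D)) ((\<lambda>(u, v). (u \<inter> Y) \<union> (X - u) \<union> v) p) = p"
      using assms by auto
    show "(\<lambda>z. (z \<inter> Y \<union> (X - z), z - ?D)) ` ?L \<subseteq> ?R"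
      by auto
    show "(\<lambda>(u, v). (u \<inter> Y) \<union> (X - u) \<union> v) ` ?R \<subseteq> ?L"
    proof (rule image_subsetI)
      fix p assume p: "p \<in> ?R"
      show "(\<lambda>(u, v). (u \<inter> Y) \<union> (X - u) \<union> v) p \<in> ?L"
        using p bspec[OF inv p] assms by (cases p) auto
    qed
  qed
  then have "card ?L = card ?R" by (rule bij_betw_same_card)
  also have "\<dots> = card {u \<in> Pow ?D. card u \<le> r} * 2 ^ card (I - ?D)"
    using assms by (simp add: card_cartesian_product card_Pow)
  also have "{u \<in> Pow ?D. card u \<le> r} = (\<Union>i\<le>r. {u. u \<subseteq> ?D \<and> card u = i})" by auto
  also have "card \<dots> = (\<Sum>i\<le>r. card {u. u \<subseteq> ?D \<and> card u = i})"
    using fD by (intro card_UN_disjoint) auto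
  also have "\<dots> = (\<Sum>i\<le>r. card ?D choose i)"
    using fD by (simp add: n_subsets)
  also have "card (I - ?D) = card I - card ?D"
    using assms fD by (simp add: card_Diff_subset)
  finally show ?thesis by (simp add: mult.commute)
qed

lemma (in prob_space) prob_space_square: "prob_space (M \<Otimes>\<^sub>M M)"
proof -
  interpret pair_prob_space M M ..
  show ?thesis by unfold_locales
qed

text \<open>Let \<open>n x\<close> count the sets containing \<open>x\<close>, which is at least 1
  by the cover, and give \<open>T z\<close> the weight \<open>f z\<close>, its indicator over
  \<open>sqrt n\<close>. The weights add up to \<open>sqrt n\<close>, while the products
  \<open>f z x * f z y\<close> add up to at most 1 on \<open>G\<close> and to 0 off it, so
  Cauchy-Schwarz over \<open>Z\<close> yields the bound.\<close>

lemma (in prob_space) square_integral_sqrt_cover_le: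
  fixes T :: "'i \<Rightarrow> 'a set"
  assumes Z: "finite Z" and T[measurable]: "\<And>z. z \<in> Z \<Longrightarrow> T z \<in> sets M"
    and G: "G \<in> sets (M \<Otimes>\<^sub>M M)" and TG: "\<And>z. z \<in> Z \<Longrightarrow> T z \<times> T z \<subseteq> G"
    and cover: "\<And>x. x \<in> space M \<Longrightarrow> \<exists>z\<in>Z. x \<in> T z"
  shows "(\<integral>x. sqrt (real (card {z \<in> Z. x \<in> T z})) \<partial>M)\<^sup>2 \<le> real (card Z) * measure (M \<Otimes>\<^sub>M M) G"
proof -
  define n where "n x = (\<Sum>z\<in>Z. indicator (T z) x :: real)" for x
  have n: "real (card {z \<in> Z. x \<in> T z}) = n x" for x
    using Z by (simp add: n_def indicator_def sum.If_cases Collect_conj_eq Int_commute)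
  have [measurable]: "n \<in> borel_measurable M"
    unfolding n_def[abs_def] by measurable
  have n1: "1 \<le> n x" if "x \<in> space M" for x
  proof -
    obtain z where "z \<in> Z" "x \<in> T z" using cover \<open>x \<in> space M\<close> by blast
    then have "indicator (T z) x \<le> n x"
      unfolding n_def using Z by (intro member_le_sum) auto
    then show ?thesis using \<open>x \<in> T z\<close> by simp
  qed
  define f where "f z x = indicator (T z) x / sqrt (n x)" for z x
  have f0: "0 \<le> f z x" if "x \<in> space M" for z x
    using n1[OF that] by (simp add: f_def)
  have f1: "f z x \<le> 1" if "x \<in> space M" for z x
    using n1[OF that] by (auto simp: f_def indicator_def)
  have [measurable]: "f z \<in> borel_measurable M" if "z \<in> Z" for z
    using T[OF that] unfolding f_def[abs_def] by measurable
  have int: "integrable M (f z)" if "z \<in> Z" for z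
    using that f0 f1 by (intro integrable_const_bound[where B=1]) auto
  define a where "a z = (\<integral>x. f z x \<partial>M)" for z
  have a0: "0 \<le> a z" for z
    unfolding a_def using f0 by (intro integral_nonneg_AE) auto
  have "(\<Sum>z\<in>Z. f z x) = sqrt (n x)" if "x \<in> space M" for x
    using n1[OF that] by (simp add: f_def n_def[symmetric] sum_divide_distrib[symmetric] real_div_sqrt)
  then have "(\<integral>x. sqrt (n x) \<partial>M) = (\<integral>x. (\<Sum>z\<in>Z. f z x) \<partial>M)"
    by (intro Bochner_Integration.integral_cong) auto
  also have "\<dots> = (\<Sum>z\<in>Z. a z)"
    using int by (simp add: a_def)
  finally have "(\<integral>x. sqrt (n x) \<partial>M)\<^sup>2 = (\<Sum>z\<in>Z. a z)\<^sup>2" by simp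
  also have "\<dots> \<le> (\<Sum>z\<in>Z. (a z)\<^sup>2) * real (card Z)"
    by (rule sum_squared_le_sum_of_squares)
  also have "\<dots> \<le> measure (M \<Otimes>\<^sub>M M) G * real (card Z)"
  proof (rule mult_right_mono)
    interpret PP: prob_space "M \<Otimes>\<^sub>M M"
      by (rule prob_space_square)
    have pointwise: "(\<Sum>z\<in>Z. f z x * f z y) \<le> indicator G (x, y)"
      if x: "x \<in> space M" and y: "y \<in> space M" for x y
    proof (cases "(x, y) \<in> G")
      case False
      then have "f z x * f z y = 0" if "z \<in> Z" for z
        using TG[OF that] by (auto simp: f_def indicator_def)
      then have "(\<Sum>z\<in>Z. f z x * f z y) = 0" by (intro sum.neutral) auto
      then show ?thesis by simp
    next
      case True
      \<comment> \<open>The number \<open>c\<close> of sets containing both points is at most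
        \<open>n x\<close> and at most \<open>n y\<close>, hence at most their geometric
        mean.\<close>
      define c where "c = (\<Sum>z\<in>Z. indicator (T z) x * indicator (T z) y :: real)"
      have c0: "0 \<le> c" unfolding c_def by (intro sum_nonneg) auto
      have "c \<le> n x" "c \<le> n y"
        unfolding c_def n_def by (auto intro!: sum_mono simp: indicator_def)
      then have "c * c \<le> n x * n y"
        using c0 by (intro mult_mono) auto
      then have "c \<le> sqrt (n x) * sqrt (n y)"
        by (metis c0 real_le_rsqrt power2_eq_square real_sqrt_mult)
      then have "c / (sqrt (n x) * sqrt (n y)) \<le> 1"
        using n1[OF x] n1[OF y] by (simp add: divide_le_eq)
      also have "c / (sqrt (n x) * sqrt (n y)) = (\<Sum>z\<in>Z. f z x * f z y)"
        by (simp add: c_def f_def sum_divide_distrib)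
      finally show ?thesis using True by simp
    qed
    \<comment> \<open>As an iterated integral over pairs, the square can be summed over
      \<open>z\<close> inside the integral, where the pointwise bound applies.\<close>
    have "ennreal ((a z)\<^sup>2) = (\<integral>\<^sup>+x. \<integral>\<^sup>+y. ennreal (f z x * f z y) \<partial>M \<partial>M)" if z: "z \<in> Z" for z
    proof -
      have eq: "ennreal (a z) = (\<integral>\<^sup>+x. ennreal (f z x) \<partial>M)"
        unfolding a_def using int[OF z] f0 by (intro nn_integral_eq_integral[symmetric]) auto
      have "(\<integral>\<^sup>+x. \<integral>\<^sup>+y. ennreal (f z x * f z y) \<partial>M \<partial>M)
          = (\<integral>\<^sup>+x. \<integral>\<^sup>+y. ennreal (f z x) * ennreal (f z y) \<partial>M \<partial>M)"
        using f0 by (intro nn_integral_cong) (simp add: ennreal_mult)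
      also have "\<dots> = ennreal (a z) * ennreal (a z)"
        using z by (simp add: nn_integral_cmult nn_integral_multc eq)
      finally show ?thesis
        using a0 by (simp add: ennreal_mult power2_eq_square)
    qed
    then have "ennreal (\<Sum>z\<in>Z. (a z)\<^sup>2) = (\<Sum>z\<in>Z. \<integral>\<^sup>+x. \<integral>\<^sup>+y. ennreal (f z x * f z y) \<partial>M \<partial>M)"
      by (subst sum_ennreal[symmetric]) auto
    also have "\<dots> = (\<integral>\<^sup>+x. \<integral>\<^sup>+y. (\<Sum>z\<in>Z. ennreal (f z x * f z y)) \<partial>M \<partial>M)"
      by (subst nn_integral_sum[symmetric], measurable, rule nn_integral_cong,
          subst nn_integral_sum) auto
    also have "\<dots> \<le> (\<integral>\<^sup>+x. \<integral>\<^sup>+y. indicator G (x, y) \<partial>M \<partial>M)"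
    proof (intro nn_integral_mono)
      fix x y assume *: "x \<in> space M" "y \<in> space M"
      have "(\<Sum>z\<in>Z. ennreal (f z x * f z y)) = ennreal (\<Sum>z\<in>Z. f z x * f z y)"
        using f0 * by (intro sum_ennreal) auto
      also have "\<dots> \<le> ennreal (indicator G (x, y))"
        using pointwise[OF *] by (rule ennreal_leI)
      finally show "(\<Sum>z\<in>Z. ennreal (f z x * f z y)) \<le> indicator G (x, y)"
        by (simp add: ennreal_indicator)
    qed
    also have "\<dots> = emeasure (M \<Otimes>\<^sub>M M) G"
      using G by (simp add: emeasure_pair_measure)
    finally show "(\<Sum>z\<in>Z. (a z)\<^sup>2) \<le> measure (M \<Otimes>\<^sub>M M) G"
      by (simp add: PP.emeasure_eq_measure)
  qed simp
  finally show ?thesis by (simp add: n mult.commute)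
qed

section \<open>Measure of the pairs separated few times\<close>

lemma real_card_eq_sum_indicator:
  "finite I \<Longrightarrow> real (card {k \<in> I. x \<in> E k}) = (\<Sum>k\<in>I. indicator (E k) x)"
  by (simp add: indicator_def sum.If_cases Collect_conj_eq)

lemma measurable_card_Collect:
  assumes "finite I" and [measurable]: "\<And>k. k \<in> I \<Longrightarrow> E k \<in> sets M"
  shows "(\<lambda>x. card {k \<in> I. x \<in> E k}) \<in> measurable M (count_space UNIV)"
proof -
  have "card {k \<in> I. x \<in> E k} = nat \<lfloor>\<Sum>k\<in>I. indicator (E k) x :: real\<rfloor>" for x
    by (simp only: real_card_eq_sum_indicator[OF assms(1), symmetric] floor_of_nat nat_int)
  moreover have "(\<lambda>x. nat \<lfloor>\<Sum>k\<in>I. indicator (E k) x :: real\<rfloor>) \<in> measurable M (count_space UNIV)"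
    by measurable
  ultimately show ?thesis by simp
qed

text \<open>The covering bound is applied to the survivor sets \<open>T z\<close> for
  \<open>z \<subseteq> I\<close>. A point \<open>x\<close> lies in the fraction
  \<open>(q x)\<^sup>2\<close> of them, so the factor \<open>2 ^ card I\<close> cancels and only the
  integral of \<open>q\<close> remains, which the tangent at \<open>s\<close> bounds from
  below.\<close>

lemma (in prob_space) measure_few_separations_ge:
  fixes A B :: "nat \<Rightarrow> 'a set" and a s :: real
  assumes I: "finite I"
    and A[measurable]: "\<And>k. A k \<in> sets M" and B[measurable]: "\<And>k. B k \<in> sets M"
    and disj: "\<And>k. A k \<inter> B k = {}"
    and s: "(\<Sum>k\<in>I. prob (A k \<union> B k)) \<le> s"
    and a: "0 < a" and r: "r = 0 \<or> 4 \<le> a \<and> a * (2 * real r + 1) \<le> s"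
  shows "2 powr (-s) * a ^ r \<le> measure (M \<Otimes>\<^sub>M M)
     {p \<in> space (M \<Otimes>\<^sub>M M). card {k \<in> I. p \<in> A k \<times> B k \<union> B k \<times> A k} \<le> 2 * r}"
    (is "_ \<le> measure _ ?G")
proof -
  define d where "d x = card {k \<in> I. x \<in> A k \<union> B k}" for x
  define q where "q x = sqrt ((\<Sum>i\<le>r. real (d x choose i)) / 2 ^ d x)" for x
  \<comment> \<open>For \<open>k \<in> z\<close> the right side is \<open>A k\<close>, so the error
    is to lie in \<open>B k\<close>; a point outside both sides never errs.\<close>
  define err where "err z x = card {k \<in> I. x \<in> (if k \<in> z then B k else A k)}" for z x
  define T where "T z = {x \<in> space M. err z x \<le> r}" for z
  have err_meas[measurable]: "err z \<in> measurable M (count_space UNIV)" for z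
    unfolding err_def[abs_def] using I by (intro measurable_card_Collect) auto
  have d_meas[measurable]: "d \<in> measurable M (count_space UNIV)"
    unfolding d_def[abs_def] using I by (intro measurable_card_Collect) auto
  have sep[measurable]: "(\<lambda>p. card {k \<in> I. p \<in> A k \<times> B k \<union> B k \<times> A k})
      \<in> measurable (M \<Otimes>\<^sub>M M) (count_space UNIV)"
    using I by (intro measurable_card_Collect) auto
  have q_meas[measurable]: "q \<in> borel_measurable M"
    unfolding q_def[abs_def] by measurable
  have dI: "d x \<le> card I" for x
    unfolding d_def using I by (intro card_mono) auto
  have err_eq: "err z x = card (z \<inter> {k \<in> I. x \<in> B k} \<union> ({k \<in> I. x \<in> A k} - z))" for z x
    unfolding err_def by (rule arg_cong[where f=card]) auto
  have card_T: "sqrt (real (card {z \<in> Pow I. x \<in> T z})) = sqrt (2 ^ card I) * q x"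
    if "x \<in> space M" for x
  proof -
    let ?X = "{k \<in> I. x \<in> A k}" and ?Y = "{k \<in> I. x \<in> B k}"
    have "card {z \<in> Pow I. x \<in> T z} = card {z \<in> Pow I. card (z \<inter> ?Y \<union> (?X - z)) \<le> r}"
      using that by (simp add: T_def err_eq)
    also have "\<dots> = 2 ^ (card I - card (?X \<union> ?Y)) * (\<Sum>i\<le>r. card (?X \<union> ?Y) choose i)"
      using I disj by (intro card_few_errors) auto
    also have "?X \<union> ?Y = {k \<in> I. x \<in> A k \<union> B k}" by auto
    finally have "card {z \<in> Pow I. x \<in> T z} = 2 ^ (card I - d x) * (\<Sum>i\<le>r. d x choose i)"
      by (simp add: d_def)
    then have "real (card {z \<in> Pow I. x \<in> T z}) = 2 ^ card I * ((\<Sum>i\<le>r. real (d x choose i)) / 2 ^ d x)"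
      using power_add[of "2::real" "card I - d x" "d x"] dI[of x] by simp
    then show ?thesis by (simp only: q_def real_sqrt_mult)
  qed
  have "(\<integral>x. sqrt (real (card {z \<in> Pow I. x \<in> T z})) \<partial>M)\<^sup>2
      \<le> real (card (Pow I)) * measure (M \<Otimes>\<^sub>M M) ?G"
  proof (rule square_integral_sqrt_cover_le)
    show "?G \<in> sets (M \<Otimes>\<^sub>M M)" by measurable
    show "T z \<in> sets M" for z unfolding T_def by measurable
    show "T z \<times> T z \<subseteq> ?G" for z
    proof (rule subrelI)
      fix x y assume "(x, y) \<in> T z \<times> T z"
      then have xy: "x \<in> T z" "y \<in> T z" by auto
      \<comment> \<open>Whenever \<open>k\<close> separates the pair, exactly one of the two points
        is on the wrong side, whatever \<open>z\<close> is.\<close>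
      have "card {k \<in> I. (x, y) \<in> A k \<times> B k \<union> B k \<times> A k} \<le>
          card ({k \<in> I. x \<in> (if k \<in> z then B k else A k)} \<union> {k \<in> I. y \<in> (if k \<in> z then B k else A k)})"
        using I by (intro card_mono) auto
      also have "\<dots> \<le> err z x + err z y"
        unfolding err_def by (rule card_Un_le)
      also have "\<dots> \<le> 2 * r" using xy by (simp add: T_def)
      finally show "(x, y) \<in> ?G" using xy by (auto simp: T_def space_pair_measure)
    qed
    fix x assume "x \<in> space M"
    \<comment> \<open>Declaring right the side that contains \<open>x\<close> produces no error at
      all, so \<open>x\<close> survives at least one choice.\<close>
    have "{k \<in> I. x \<in> (if k \<in> {k \<in> I. x \<in> A k} then B k else A k)} = {}"
      using disj by auto
    then have "err {k \<in> I. x \<in> A k} x = 0"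
      unfolding err_def by (simp only: card.empty)
    then have "x \<in> T {k \<in> I. x \<in> A k}"
      using \<open>x \<in> space M\<close> unfolding T_def by simp
    then show "\<exists>z\<in>Pow I. x \<in> T z" by blast
  qed (use I in auto)
  also have "(\<integral>x. sqrt (real (card {z \<in> Pow I. x \<in> T z})) \<partial>M) = (\<integral>x. sqrt (2 ^ card I) * q x \<partial>M)"
    using card_T by (intro Bochner_Integration.integral_cong) auto
  finally have le: "(\<integral>x. q x \<partial>M)\<^sup>2 \<le> measure (M \<Otimes>\<^sub>M M) ?G"
    using I by (simp add: power_mult_distrib card_Pow)
  define g where "g = 2 powr (-s/2) * a powr (real r / 2)"
  have g0: "0 \<le> g" by (simp add: g_def)
  have q0: "0 \<le> q x" for x by (simp add: q_def sum_nonneg)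
  \<comment> \<open>A crude constant bound, serving only the integrability of
    \<open>q\<close>.\<close>
  have q1: "q x \<le> sqrt (\<Sum>i\<le>r. 2 ^ card I)" for x
  proof -
    have "real (d x choose i) \<le> 2 ^ card I" for i
    proof -
      have "d x choose i \<le> 2 ^ d x" by (rule binomial_le_pow2)
      also have "\<dots> \<le> 2 ^ card I" using dI by simp
      finally show ?thesis by (metis of_nat_le_iff of_nat_numeral of_nat_power)
    qed
    then have "(\<Sum>i\<le>r. real (d x choose i)) / 2 ^ d x \<le> (\<Sum>i\<le>r. 2 ^ card I) / 1"
      by (intro frac_le sum_mono sum_nonneg) auto
    then show ?thesis by (simp add: q_def)
  qed
  have int_q: "integrable M q"
    using q0 q1 by (intro integrable_const_bound[where B="sqrt (\<Sum>i\<le>r. 2 ^ card I)"]) auto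
  have d_sum: "real (d x) = (\<Sum>k\<in>I. indicator (A k \<union> B k) x)" for x
    unfolding d_def using I by (rule real_card_eq_sum_indicator)
  have "(\<integral>x. real (d x) \<partial>M) = (\<Sum>k\<in>I. prob (A k \<union> B k))"
    unfolding d_sum by (subst Bochner_Integration.integral_sum)
      (auto simp: emeasure_eq_measure)
  then have d_int: "(\<integral>x. real (d x) \<partial>M) \<le> s" using s by simp
  have int_d: "integrable M (\<lambda>x. real (d x))"
    using dI by (intro integrable_const_bound[where B="real (card I)"]) auto
  \<comment> \<open>The tangent decreases in \<open>d\<close> and the mean of \<open>d\<close> is at
    most \<open>s\<close>, so its integral is at least its value \<open>g\<close> at
    \<open>s\<close>.\<close>
  have "g \<le> g * (1 + (s - (\<integral>x. real (d x) \<partial>M)) / 2 * ln 2)"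
    using g0 d_int mult_left_mono[of 1 "1 + (s - (\<integral>x. real (d x) \<partial>M)) / 2 * ln 2" g] by simp
  also have "\<dots> = (\<integral>x. g * (1 + (s - real (d x)) / 2 * ln 2) \<partial>M)"
    using int_d by (simp add: prob_space)
  also have "\<dots> \<le> (\<integral>x. q x \<partial>M)"
  proof (rule integral_mono)
    show "integrable M (\<lambda>x. g * (1 + (s - real (d x)) / 2 * ln 2))" using int_d by simp
    show "g * (1 + (s - real (d x)) / 2 * ln 2) \<le> q x" for x
      unfolding g_def q_def by (rule sqrt_hamming_ball_ge_tangent[OF a r])
  qed (rule int_q)
  finally have "g\<^sup>2 \<le> (\<integral>x. q x \<partial>M)\<^sup>2" using g0 by (simp add: power_mono)
  also have "g\<^sup>2 = (2 powr (-s/2) * 2 powr (-s/2)) * (a powr (real r / 2) * a powr (real r / 2))"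
    by (simp only: g_def power2_eq_square mult_ac)
  also have "\<dots> = 2 powr (-s) * a powr (real r)"
    unfolding powr_add[symmetric] by simp
  also have "\<dots> = 2 powr (-s) * a ^ r"
    using a by (simp only: powr_realpow)
  finally show ?thesis using le by simp
qed

section \<open>Missing weight and the two lower bounds\<close>

text \<open>A pair separated at most \<open>2 * r\<close> times collects weight at most
  \<open>2 * r * \<delta>\<close> and so misses at least \<open>1 - 2 * r * \<delta>\<close>. Such
  pairs have measure at least \<open>2 powr (-s) * a ^ r\<close>, while the total missing weight is
  at most \<open>\<epsilon>\<close>.\<close>

lemma (in prob_space) deficit_ge:
  fixes A B :: "nat \<Rightarrow> 'a set" and a s \<delta> \<epsilon> :: real
  assumes A[measurable]: "\<And>k. A k \<in> sets M" and B[measurable]: "\<And>k. B k \<in> sets M"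
    and disj: "\<And>k. A k \<inter> B k = {}"
    and s: "(\<Sum>k. emeasure M (A k \<union> B k)) = ennreal s" "0 \<le> s"
    and a: "0 < a" and r: "r = 0 \<or> 4 \<le> a \<and> a * (2 * real r + 1) \<le> s"
    and \<delta>: "0 < \<delta>" "2 * real r * \<delta> \<le> 1"
    and full: "ennreal (1 - \<epsilon>) \<le>
      (\<integral>\<^sup>+p. min 1 (\<Sum>k. ennreal \<delta> * indicator (A k \<times> B k \<union> B k \<times> A k) p) \<partial>(M \<Otimes>\<^sub>M M))"
  shows "(1 - 2 * real r * \<delta>) * (2 powr (-s) * a ^ r) \<le> \<epsilon>"
proof -
  interpret PP: prob_space "M \<Otimes>\<^sub>M M"
    by (rule prob_space_square)
  define g where "g = 2 powr (-s) * a ^ r"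
  define E where "E k = A k \<times> B k \<union> B k \<times> A k" for k
  have [measurable]: "E k \<in> sets (M \<Otimes>\<^sub>M M)" for k unfolding E_def by measurable
  \<comment> \<open>The measure bound concerns finitely many indices, so the sum is cut off at
    \<open>m\<close>. The resulting estimate is uniform in \<open>m\<close> and passes to the
    supremum.\<close>
  define h where "h m p = min 1 (\<Sum>k<m. ennreal \<delta> * indicator (E k) p)" for m p
  define c where "c = 1 - 2 * real r * \<delta>"
  have c0: "0 \<le> c" using \<delta> by (simp add: c_def)
  \<comment> \<open>The first conjunct is carried along because \<open>ennreal\<close> maps negative
    reals to 0, and the final comparison is between reals.\<close>
  have bound: "c * g \<le> 1 \<and> (\<integral>\<^sup>+p. h m p \<partial>(M \<Otimes>\<^sub>M M)) \<le> ennreal (1 - c * g)" for m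
  proof -
    define G where "G = {p \<in> space (M \<Otimes>\<^sub>M M). card {k \<in> {..<m}. p \<in> A k \<times> B k \<union> B k \<times> A k} \<le> 2 * r}"
    have "(\<lambda>p. card {k \<in> {..<m}. p \<in> A k \<times> B k \<union> B k \<times> A k}) \<in> measurable (M \<Otimes>\<^sub>M M) (count_space UNIV)"
      by (intro measurable_card_Collect) auto
    then have [measurable]: "G \<in> sets (M \<Otimes>\<^sub>M M)" unfolding G_def by measurable
    have "ennreal (\<Sum>k<m. prob (A k \<union> B k)) = (\<Sum>k<m. emeasure M (A k \<union> B k))"
      by (simp add: emeasure_eq_measure)
    also have "\<dots> \<le> ennreal s" unfolding s(1)[symmetric] by (rule sum_le_suminf) auto
    finally have "(\<Sum>k<m. prob (A k \<union> B k)) \<le> s" using s(2) by simp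
    then have gG: "g \<le> PP.prob G"
      unfolding g_def G_def using a r disj by (intro measure_few_separations_ge) auto
    have "c * g \<le> c * PP.prob G" using gG c0 by (rule mult_left_mono)
    moreover have "c * PP.prob G \<le> 1 * 1"
      using \<delta> by (intro mult_mono) (auto simp: c_def)
    ultimately have cg: "c * g \<le> c * PP.prob G" "c * g \<le> 1" by auto
    have "(\<integral>\<^sup>+p. h m p \<partial>(M \<Otimes>\<^sub>M M)) \<le> (\<integral>\<^sup>+p. ennreal (1 - c * indicator G p) \<partial>(M \<Otimes>\<^sub>M M))"
    proof (rule nn_integral_mono)
      fix p assume p: "p \<in> space (M \<Otimes>\<^sub>M M)"
      show "h m p \<le> ennreal (1 - c * indicator G p)"
      proof (cases "p \<in> G")
        case True
        have "(\<Sum>k<m. ennreal \<delta> * indicator (E k) p) = ennreal (\<Sum>k<m. \<delta> * indicator (E k) p)"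
          using \<delta> by (subst sum_ennreal[symmetric]) (auto simp: ennreal_mult ennreal_indicator)
        also have "(\<Sum>k<m. \<delta> * indicator (E k) p) = \<delta> * real (card {k \<in> {..<m}. p \<in> E k})"
          by (simp only: sum_distrib_left real_card_eq_sum_indicator finite_lessThan)
        also have "ennreal \<dots> \<le> ennreal (2 * real r * \<delta>)"
        proof (rule ennreal_leI)
          have "real (card {k \<in> {..<m}. p \<in> E k}) \<le> 2 * real r"
            using True unfolding G_def E_def by simp
          then show "\<delta> * real (card {k \<in> {..<m}. p \<in> E k}) \<le> 2 * real r * \<delta>"
            using \<delta> by (simp add: mult.commute)
        qed
        finally show ?thesis using True by (simp add: h_def c_def min.coboundedI2)
      qed (simp add: h_def)
    qed
    also have "\<dots> = ennreal (\<integral>p. 1 - c * indicator G p \<partial>(M \<Otimes>\<^sub>M M))"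
    proof (rule nn_integral_eq_integral)
      show "integrable (M \<Otimes>\<^sub>M M) (\<lambda>p. 1 - c * indicator G p :: real)"
        by (auto intro!: integrable_real_indicator simp: PP.emeasure_eq_measure)
      show "AE p in M \<Otimes>\<^sub>M M. 0 \<le> 1 - c * indicator G p"
        using \<delta> by (auto simp: c_def indicator_def)
    qed
    also have "(\<integral>p. 1 - c * indicator G p \<partial>(M \<Otimes>\<^sub>M M)) = 1 - c * PP.prob G"
      by (subst Bochner_Integration.integral_diff)
        (auto intro!: integrable_real_indicator simp: PP.prob_space PP.emeasure_eq_measure)
    also have "ennreal (1 - c * PP.prob G) \<le> ennreal (1 - c * g)" using cg by (intro ennreal_leI) simp
    finally show ?thesis using cg by simp
  qed
  have "min 1 (\<Sum>k. ennreal \<delta> * indicator (E k) p) = (SUP m. h m p)" for p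
    unfolding h_def by (simp only: suminf_eq_SUP inf_min[symmetric] inf_SUP)
  then have "ennreal (1 - \<epsilon>) \<le> (\<integral>\<^sup>+p. (SUP m. h m p) \<partial>(M \<Otimes>\<^sub>M M))"
    using full by (simp add: E_def)
  also have "\<dots> = (SUP m. \<integral>\<^sup>+p. h m p \<partial>(M \<Otimes>\<^sub>M M))"
  proof (rule nn_integral_monotone_convergence_SUP)
    show "incseq h"
      unfolding h_def incseq_def le_fun_def
      by (intro allI impI min.mono order_refl sum_mono2) auto
    show "h m \<in> borel_measurable (M \<Otimes>\<^sub>M M)" for m
      unfolding h_def by measurable
  qed
  also have "\<dots> \<le> ennreal (1 - c * g)" using bound by (intro SUP_least) auto
  finally have "1 - \<epsilon> \<le> 1 - c * g" using bound by simp
  then show ?thesis by (simp add: c_def g_def)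
qed

text \<open>Applied to \<open>1 / \<delta>\<close>, this lets the subtracted
  \<open>1 / \<delta>\<close> of the theorem absorb the cost \<open>- log 2 \<delta>\<close> of a
  factor \<open>\<delta>\<close>.\<close>

lemma log2_le_self:
  fixes x :: real
  assumes "1 \<le> x"
  shows "log 2 x \<le> x"
proof -
  have "(x - 1) * (1 / 2) \<le> (x - 1) * ln 2"
    using assms ln2_ge_two_thirds by (intro mult_left_mono) auto
  then have "x - 1 \<le> 2 * ((x - 1) * ln 2)" by simp
  then have "x \<le> 2 * (1 + (x - 1) * ln 2)" unfolding distrib_left by simp
  also have "\<dots> \<le> 2 * 2 powr (x - 1)" by (intro mult_left_mono two_powr_ge) auto
  also have "\<dots> = 2 powr (1 + (x - 1))" by (subst powr_add) simp
  finally show ?thesis using assms by (simp add: log_le_iff)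
qed

lemma (in prob_space) sum_measure_sides_ge:
  fixes A B :: "nat \<Rightarrow> 'a set" and \<delta> \<epsilon> :: real
  assumes A[measurable]: "\<And>k. A k \<in> sets M" and B[measurable]: "\<And>k. B k \<in> sets M"
    and disj: "\<And>k. A k \<inter> B k = {}"
    and \<epsilon>: "0 < \<epsilon>" "\<epsilon> < 1" and \<delta>: "0 < \<delta>" "\<delta> \<le> 1"
    and full: "ennreal (1 - \<epsilon>) \<le>
      (\<integral>\<^sup>+p. min 1 (\<Sum>k. ennreal \<delta> * indicator (A k \<times> B k \<union> B k \<times> A k) p) \<partial>(M \<Otimes>\<^sub>M M))"
  shows "ennreal (max (2 * (1 - \<epsilon>) / \<delta>)
      (log 2 (1 / \<epsilon>) + of_int \<lfloor>(1 - \<delta>) / (2 * \<delta>)\<rfloor> * log 2 (\<delta> * log 2 (1 / \<epsilon>)) - 1 / \<delta> - 1))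
    \<le> (\<Sum>k. emeasure M (A k \<union> B k))"
proof (cases "(\<Sum>k. emeasure M (A k \<union> B k))")
  case (real s)
  have "2 * (1 - \<epsilon>) / \<delta> \<le> s"
  proof -
    have "ennreal (1 - \<epsilon>) \<le> (\<integral>\<^sup>+p. (\<Sum>k. ennreal \<delta> * indicator (A k \<times> B k \<union> B k \<times> A k) p) \<partial>(M \<Otimes>\<^sub>M M))"
      by (rule order_trans[OF full]) (auto intro!: nn_integral_mono)
    also have "\<dots> = (\<Sum>k. ennreal \<delta> * emeasure (M \<Otimes>\<^sub>M M) (A k \<times> B k \<union> B k \<times> A k))"
      by (subst nn_integral_suminf) (auto simp: nn_integral_cmult)
    also have "\<dots> \<le> (\<Sum>k. ennreal (\<delta> / 2) * emeasure M (A k \<union> B k))"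
    proof (intro suminf_le summableI allI)
      fix k
      let ?a = "prob (A k)" and ?b = "prob (B k)"
      have ab: "prob (A k \<union> B k) = ?a + ?b"
        using disj[of k] by (intro finite_measure_Union) auto
      \<comment> \<open>AM-GM bounds the product by a square, and \<open>?a + ?b \<le> 1\<close> for
        disjoint sides makes the bound linear in \<open>prob (A k \<union> B k)\<close>.\<close>
      have "0 \<le> (?a - ?b)\<^sup>2" by simp
      then have "4 * (?a * ?b) \<le> (?a + ?b) * (?a + ?b)"
        by (simp add: power2_eq_square algebra_simps)
      also have "\<dots> \<le> (?a + ?b) * 1"
        using ab prob_le_1[of "A k \<union> B k"] by (intro mult_left_mono) auto
      finally have *: "2 * \<delta> * (?a * ?b) \<le> \<delta> / 2 * (?a + ?b)"
        using \<delta> by (simp add: mult.assoc[symmetric])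
      have "emeasure (M \<Otimes>\<^sub>M M) (A k \<times> B k \<union> B k \<times> A k)
          \<le> emeasure (M \<Otimes>\<^sub>M M) (A k \<times> B k) + emeasure (M \<Otimes>\<^sub>M M) (B k \<times> A k)"
        by (rule emeasure_subadditive) auto
      also have "\<dots> = ennreal (2 * (?a * ?b))"
        by (simp add: emeasure_pair_measure_Times emeasure_eq_measure ennreal_mult[symmetric]
            ennreal_plus[symmetric] del: ennreal_plus)
      finally have "ennreal \<delta> * emeasure (M \<Otimes>\<^sub>M M) (A k \<times> B k \<union> B k \<times> A k)
          \<le> ennreal \<delta> * ennreal (2 * (?a * ?b))" by (rule mult_left_mono) simp
      also have "\<dots> = ennreal (2 * \<delta> * (?a * ?b))"
        using \<delta> by (subst ennreal_mult[symmetric]) (auto simp: mult_ac)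
      also have "\<dots> \<le> ennreal (\<delta> / 2 * prob (A k \<union> B k))" using * ab by (intro ennreal_leI) simp
      also have "\<dots> = ennreal (\<delta> / 2) * emeasure M (A k \<union> B k)"
        using \<delta> by (subst ennreal_mult) (auto simp: emeasure_eq_measure)
      finally show "ennreal \<delta> * emeasure (M \<Otimes>\<^sub>M M) (A k \<times> B k \<union> B k \<times> A k)
          \<le> ennreal (\<delta> / 2) * emeasure M (A k \<union> B k)" .
    qed
    also have "\<dots> = ennreal (\<delta> / 2 * s)"
      using real \<delta> by (simp only: ennreal_suminf_cmult ennreal_mult[of "\<delta> / 2" s])
    finally have "1 - \<epsilon> \<le> \<delta> / 2 * s"
      using \<delta> real by (subst (asm) ennreal_le_iff) auto
    then show ?thesis using \<delta> by (simp add: field_simps)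
  qed
  moreover
  define L where "L = log 2 (1 / \<epsilon>)"
  \<comment> \<open>This is the largest \<open>r\<close> for which
    \<open>1 - 2 * r * \<delta>\<close> is still at least \<open>\<delta>\<close>.\<close>
  define r where "r = nat \<lfloor>(1 - \<delta>) / (2 * \<delta>)\<rfloor>"
  have "0 \<le> \<lfloor>(1 - \<delta>) / (2 * \<delta>)\<rfloor>" using \<delta> by simp
  then have r_eq: "of_int \<lfloor>(1 - \<delta>) / (2 * \<delta>)\<rfloor> = real r" by (simp add: r_def)
  have "real r \<le> (1 - \<delta>) / (2 * \<delta>)" unfolding r_eq[symmetric] by simp
  then have r: "2 * real r * \<delta> \<le> 1 - \<delta>" using \<delta> by (simp add: field_simps)
  then have r': "2 * real r + 1 \<le> 1 / \<delta>" using \<delta> by (simp add: field_simps)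
  have L0: "0 < L" using \<epsilon> by (simp add: L_def)
  have log\<epsilon>: "log 2 \<epsilon> = - L" using \<epsilon> by (simp add: L_def log_divide)
  \<comment> \<open>The instance \<open>r = 0\<close>, \<open>a = 1\<close> says
    \<open>2 powr (-s) \<le> \<epsilon>\<close>.\<close>
  have "(1 - 2 * real 0 * \<delta>) * (2 powr (-s) * 1 ^ 0) \<le> \<epsilon>"
    using A B disj real \<delta> full by (intro deficit_ge) auto
  then have "log 2 (2 powr (-s)) \<le> log 2 \<epsilon>" using \<epsilon> by (subst log_le_cancel_iff) auto
  then have Ls: "L \<le> s" using log\<epsilon> by simp
  have "L + real r * log 2 (\<delta> * L) - 1 / \<delta> - 1 \<le> s"
  proof (cases "\<delta> * L < 4")
    case True
    \<comment> \<open>The logarithm is at most 2 and \<open>2 * r \<le> 1 / \<delta> - 1\<close>, so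
      the subtracted terms outweigh the middle one and \<open>L \<le> s\<close> suffices.\<close>
    have "log 2 (\<delta> * L) \<le> log 2 4"
      using True \<delta> L0 by (subst log_le_cancel_iff) auto
    also have "log 2 4 = (2::real)" using log_pow_cancel[of 2 2] by simp
    finally have "real r * log 2 (\<delta> * L) \<le> real r * 2" by (rule mult_left_mono) simp
    then show ?thesis using Ls r' by simp
  next
    case False
    \<comment> \<open>With \<open>a = \<delta> * L\<close> the side condition reads
      \<open>a * (2 * r + 1) \<le> L \<le> s\<close>.\<close>
    have "\<delta> * L * (2 * real r + 1) \<le> \<delta> * L * (1 / \<delta>)"
      using r' L0 \<delta> by (intro mult_left_mono) auto
    then have "\<delta> * L * (2 * real r + 1) \<le> s" using Ls \<delta> by simp
    then have "(1 - 2 * real r * \<delta>) * (2 powr (-s) * (\<delta> * L) ^ r) \<le> \<epsilon>"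
      using A B disj real \<delta> full False L0 r by (intro deficit_ge) auto
    moreover have "\<delta> * (2 powr (-s) * (\<delta> * L) ^ r) \<le> (1 - 2 * real r * \<delta>) * (2 powr (-s) * (\<delta> * L) ^ r)"
      using r \<delta> L0 by (intro mult_right_mono) auto
    ultimately have "\<delta> * (2 powr (-s) * (\<delta> * L) ^ r) \<le> \<epsilon>" by linarith
    then have "log 2 (\<delta> * (2 powr (-s) * (\<delta> * L) ^ r)) \<le> log 2 \<epsilon>"
      using \<epsilon> \<delta> L0 by (subst log_le_cancel_iff) auto
    also have "log 2 (\<delta> * (2 powr (-s) * (\<delta> * L) ^ r)) = log 2 \<delta> + (- s + real r * log 2 (\<delta> * L))"
      using \<delta> L0 by (subst log_mult, simp, simp, subst log_mult) (simp_all add: log_nat_power)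
    finally have "log 2 \<delta> - s + real r * log 2 (\<delta> * L) \<le> - L" using log\<epsilon> by simp
    moreover have "- log 2 \<delta> \<le> 1 / \<delta>"
      using log2_le_self[of "1 / \<delta>"] \<delta> by (simp add: log_divide)
    ultimately show ?thesis by simp
  qed
  ultimately show ?thesis
    unfolding real(2) r_eq L_def[symmetric] by (intro ennreal_leI) simp
qed simp

section \<open>Borel sides and null sets\<close>

lemma null_sets_lebesgue_Times_UNIV:
  fixes C :: "real set"
  assumes "C \<in> null_sets lebesgue"
  shows "C \<times> (UNIV :: real set) \<in> null_sets lebesgue" "(UNIV :: real set) \<times> C \<in> null_sets lebesgue"
proof -
  obtain N where N: "N \<in> null_sets lborel" "C \<subseteq> N"
    using assms by (auto simp: null_sets_completion_iff2)
  have "N \<times> (UNIV :: real set) \<in> null_sets (lborel \<Otimes>\<^sub>M lborel)"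
    using N by (intro lborel.times_in_null_sets1) auto
  moreover have "(UNIV :: real set) \<times> N \<in> null_sets (lborel \<Otimes>\<^sub>M lborel)"
    using N by (intro lborel.times_in_null_sets2) auto
  ultimately have *: "N \<times> (UNIV :: real set) \<in> null_sets lborel" "(UNIV :: real set) \<times> N \<in> null_sets lborel"
    by (simp_all add: lborel_prod)
  show "C \<times> (UNIV :: real set) \<in> null_sets lebesgue"
    using N(2) by (intro null_sets_completion_subset[OF _ null_sets_completionI[OF *(1)]]) auto
  show "(UNIV :: real set) \<times> C \<in> null_sets lebesgue"
    using N(2) by (intro null_sets_completion_subset[OF _ null_sets_completionI[OF *(2)]]) auto
qed

text \<open>The probabilistic bounds need Borel sides that are disjoint outright. Passing to Borel
  main parts and deleting the overlap changes the sides only within a null set \<open>C\<close>, and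
  the support only within the null strips over \<open>C\<close>.\<close>

lemma bipartite_wrt_borel_sides:
  assumes "bipartite_wrt A B W"
  obtains A' B' where "A' \<in> sets borel" "B' \<in> sets borel" "A' \<inter> B' = {}"
    "A' \<subseteq> {0..1}" "B' \<subseteq> {0..1}" "emeasure lborel (A' \<union> B') = emeasure lebesgue (A \<union> B)"
    "graphon_supp W - (A' \<times> B' \<union> B' \<times> A') \<in> null_sets lebesgue"
proof -
  have A: "A \<in> sets lebesgue" "A \<subseteq> {0..1}" and B: "B \<in> sets lebesgue" "B \<subseteq> {0..1}"
    and AB: "A \<inter> B \<in> null_sets lebesgue"
    and supp: "graphon_supp W - (A \<times> B \<union> B \<times> A) \<in> null_sets lebesgue"
    using assms by (auto simp: bipartite_wrt_def)
  define A' where "A' = main_part lborel A"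
  define B' where "B' = main_part lborel B - A'"
  define C where "C = null_part lborel A \<union> null_part lborel B \<union> (A \<inter> B)"
  have A_eq: "A = A' \<union> null_part lborel A" "B = main_part lborel B \<union> null_part lborel B"
    using A B main_part_null_part_Un[of A lborel] main_part_null_part_Un[of B lborel]
    by (auto simp: A'_def)
  have C: "C \<in> null_sets lebesgue"
    unfolding C_def using AB A B by (intro null_sets.Un null_part_null_sets) auto
  have borel: "A' \<in> sets borel" "B' \<in> sets borel"
    using main_part_sets[OF A(1)] main_part_sets[OF B(1)] by (auto simp: A'_def B'_def)
  have sub: "A' \<subseteq> A" "B' \<subseteq> B" using A_eq by (auto simp: B'_def)
  have cov: "A \<subseteq> A' \<union> C" "B \<subseteq> B' \<union> C"
    using A_eq by (auto simp: B'_def C_def)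
  have "emeasure lborel (A' \<union> B') = emeasure lebesgue (A' \<union> B')"
    using borel by simp
  also have "\<dots> = emeasure lebesgue ((A' \<union> B') \<union> C)"
    using borel C by (intro emeasure_Un_null_set[symmetric]) auto
  also have "(A' \<union> B') \<union> C = (A \<union> B) \<union> C" using sub cov by auto
  also have "emeasure lebesgue \<dots> = emeasure lebesgue (A \<union> B)"
    using A B C by (intro emeasure_Un_null_set) auto
  finally have m: "emeasure lborel (A' \<union> B') = emeasure lebesgue (A \<union> B)" .
  have "(graphon_supp W - (A \<times> B \<union> B \<times> A)) \<union> (C \<times> UNIV \<union> UNIV \<times> C) \<in> null_sets lebesgue"
    by (intro null_sets.Un supp null_sets_lebesgue_Times_UNIV C)
  then have "graphon_supp W - (A' \<times> B' \<union> B' \<times> A') \<in> null_sets lebesgue"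
    by (rule null_sets_completion_subset[rotated]) (use cov in auto)
  moreover have "A' \<inter> B' = {}" by (auto simp: B'_def)
  ultimately show ?thesis using that[of A' B'] borel m sub A B by auto
qed

text \<open>The infimum is not known to be attained, so the set is covered by the null sets where
  \<open>W\<close> exceeds \<open>\<delta> + 1 / (n + 1)\<close>.\<close>

lemma graphon_gt_supnorm_null:
  assumes W: "graphon W" and le: "graphon_supnorm W \<le> \<delta>"
  shows "{(x, y) \<in> unit_square. W x y > \<delta>} \<in> null_sets lebesgue"
proof -
  let ?S = "{\<alpha> \<in> {0..1}. {(x, y) \<in> unit_square. W x y > \<alpha>} \<in> null_sets lebesgue}"
  \<comment> \<open>Membership of 1 makes the set under the infimum nonempty, so that
    \<open>Inf\<close> has its usual meaning.\<close>
  have "{(x, y) \<in> unit_square. W x y > 1} = {}"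
    using W by (force simp: graphon_def)
  then have "{(x, y) \<in> unit_square. W x y > 1} \<in> null_sets lebesgue" by (simp only: null_sets.empty_sets)
  then have "1 \<in> ?S" by simp
  then have ne: "?S \<noteq> {}" by blast
  have null: "{(x, y) \<in> unit_square. W x y > \<delta> + inverse (real (Suc n))} \<in> null_sets lebesgue" for n
  proof -
    have "Inf ?S \<le> \<delta>" using le by (simp only: graphon_supnorm_def)
    moreover have "0 < inverse (real (Suc n))" by simp
    ultimately have "Inf ?S < \<delta> + inverse (real (Suc n))" by linarith
    then obtain \<alpha> where \<alpha>: "\<alpha> \<in> ?S" "\<alpha> < \<delta> + inverse (real (Suc n))"
      using cInf_lessD[OF ne] by blast
    then have "{(x, y) \<in> unit_square. W x y > \<alpha>} \<in> null_sets lebesgue" by blast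
    then show ?thesis by (rule null_sets_completion_subset[rotated]) (use \<alpha>(2) in auto)
  qed
  have "(\<Union>n. {(x, y) \<in> unit_square. W x y > \<delta> + inverse (real (Suc n))}) \<in> null_sets lebesgue"
    using null by (rule null_sets_UN)
  moreover have "{(x, y) \<in> unit_square. W x y > \<delta>}
      \<subseteq> (\<Union>n. {(x, y) \<in> unit_square. W x y > \<delta> + inverse (real (Suc n))})"
  proof clarsimp
    fix x y assume "\<delta> < W x y"
    then obtain n where "inverse (real (Suc n)) < W x y - \<delta>"
      using reals_Archimedean[of "W x y - \<delta>"] by auto
    then show "\<exists>n. \<delta> + inverse (1 + real n) < W x y" by (intro exI[of _ n]) auto
  qed
  ultimately show ?thesis using null_sets_completion_subset by blast
qed

lemma infsum_ennreal_eq_suminf: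
  fixes f :: "nat \<Rightarrow> ennreal"
  shows "infsum f S = (\<Sum>k. if k \<in> S then f k else 0)"
proof -
  have "infsum f S = infsum (\<lambda>k. if k \<in> S then f k else 0) UNIV"
    by (rule infsum_cong_neutral) auto
  moreover have "(\<lambda>k. if k \<in> S then f k else 0) summable_on UNIV"
    by (intro nonneg_summable_on_complete) auto
  ultimately show ?thesis
    by (metis has_sum_imp_sums has_sum_infsum sums_unique)
qed

section \<open>Transfer from graphons to the uniform probability space\<close>

theorem theorem1p8:
  fixes \<epsilon> \<delta> :: real
    and N :: enat
    and W :: "nat \<Rightarrow> real \<Rightarrow> real \<Rightarrow> real"
    and A B :: "nat \<Rightarrow> real set"
  assumes "0 < \<epsilon>" and "\<epsilon> < 1" and "0 < \<delta>" and "\<delta> \<le> 1"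
    and "separating_system N W"
    and "full (1 - \<epsilon>) N W"
    and "\<And>k. k \<in> indices N \<Longrightarrow> bipartite_wrt (A k) (B k) (W k)"
    and "\<And>k. k \<in> indices N \<Longrightarrow> graphon_supnorm (W k) \<le> \<delta>"
  shows "(\<Sum>\<^sub>\<infinity>k\<in>indices N. emeasure lebesgue (A k \<union> B k)) \<ge>
    ennreal (max (2 * (1 - \<epsilon>) / \<delta>)
      (log 2 (1 / \<epsilon>)
        + of_int \<lfloor>(1 - \<delta>) / (2 * \<delta>)\<rfloor> * log 2 (\<delta> * log 2 (1 / \<epsilon>))
        - 1 / \<delta> - 1))"
proof -
  \<comment> \<open>Indices outside the system receive empty sides, so that the sequences are total
    and the extra terms are 0.\<close>
  let ?sides = "\<lambda>k A' B'. A' \<in> sets borel \<and> B' \<in> sets borel \<and> A' \<inter> B' = {} \<and>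
      A' \<subseteq> {0..1} \<and> B' \<subseteq> {0..1} \<and>
      emeasure lborel (A' \<union> B') = (if k \<in> indices N then emeasure lebesgue (A k \<union> B k) else 0) \<and>
      (k \<in> indices N \<longrightarrow> graphon_supp (W k) - (A' \<times> B' \<union> B' \<times> A') \<in> null_sets lebesgue)"
  have "\<exists>A' B'. ?sides k A' B'" for k
  proof (cases "k \<in> indices N")
    case True
    show ?thesis
      using bipartite_wrt_borel_sides[OF assms(7)[OF True]] True by (smt (verit))
  next
    case False
    then show ?thesis by (intro exI[of _ "{}"]) auto
  qed
  then obtain A' B' where sides: "\<And>k. ?sides k (A' k) (B' k)" by metis
  define E where "E k = A' k \<times> B' k \<union> B' k \<times> A' k" for k
  \<comment> \<open>The uniform measure is taken as a density on the whole line, so its square is a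
    density of \<open>lborel\<close> on the plane.\<close>
  define U :: "real measure" where "U = density lborel (indicator {0..1})"
  have sets_U[simp, measurable_cong]: "sets U = sets borel" by (simp add: U_def)
  interpret U: prob_space U
    by (rule prob_spaceI) (simp add: U_def emeasure_density)
  have emeasure_U: "emeasure U X = emeasure lborel X" if "X \<in> sets borel" "X \<subseteq> {0..1}" for X
  proof -
    have "emeasure U X = (\<integral>\<^sup>+x. indicator {0..1} x * indicator X x \<partial>lborel)"
      using that by (simp add: U_def emeasure_density)
    also have "\<dots> = (\<integral>\<^sup>+x. indicator X x \<partial>lborel)"
      using that by (intro nn_integral_cong) (auto simp: indicator_def)
    finally show ?thesis using that by simp
  qed
  have UU: "U \<Otimes>\<^sub>M U = density lborel (indicator unit_square)"
  proof -
    have "U \<Otimes>\<^sub>M U = density (lborel \<Otimes>\<^sub>M lborel) (\<lambda>(x, y). indicator {0..1} x * indicator {0..1} y)"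
      unfolding U_def
      by (rule pair_measure_density)
        (use U.sigma_finite_measure_axioms in \<open>auto simp: U_def lborel.sigma_finite_measure_axioms\<close>)
    also have "(\<lambda>(x, y). indicator {0..1} x * indicator {0..1} y) = (indicator unit_square :: real \<times> real \<Rightarrow> ennreal)"
      by (auto simp: fun_eq_iff indicator_def)
    finally show ?thesis by (simp add: lborel_prod)
  qed
  have [measurable]: "A' k \<in> sets borel" "B' k \<in> sets borel" for k using sides by auto
  have E_borel[measurable]: "E k \<in> sets borel" for k
    unfolding E_def by (metis borel_prod pair_measureI sets.Un sides)
  have square[measurable]: "unit_square \<in> sets (borel :: (real \<times> real) measure)"
    by (metis atLeastAtMost_borel borel_prod pair_measureI)
  \<comment> \<open>Countably many indices allow one exceptional null set for all
    \<open>k\<close>.\<close>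
  have W_le: "AE p in lebesgue_on unit_square. case p of (x, y) \<Rightarrow>
      \<forall>k\<in>indices N. ennreal (W k x y) \<le> ennreal \<delta> * indicator (E k) p"
  proof -
    have "AE p in lebesgue. \<forall>k\<in>indices N. p \<in> unit_square \<longrightarrow>
        (case p of (x, y) \<Rightarrow> ennreal (W k x y) \<le> ennreal \<delta> * indicator (E k) p)"
    proof (subst AE_ball_countable; safe?)
      fix k assume k: "k \<in> indices N"
      have "graphon_supp (W k) - E k \<in> null_sets lebesgue"
        using sides[of k] k by (simp add: E_def)
      moreover have "{(x, y) \<in> unit_square. W k x y > \<delta>} \<in> null_sets lebesgue"
        using assms(7,8)[OF k] by (intro graphon_gt_supnorm_null) (auto simp: bipartite_wrt_def)
      ultimately have "AE p in lebesgue. p \<notin> graphon_supp (W k) - E k \<and>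
          p \<notin> {(x, y) \<in> unit_square. W k x y > \<delta>}"
        by (auto dest!: AE_not_in)
      then show "AE p in lebesgue. p \<in> unit_square \<longrightarrow>
          (case p of (x, y) \<Rightarrow> ennreal (W k x y) \<le> ennreal \<delta> * indicator (E k) p)"
        by eventually_elim (auto simp: graphon_supp_def indicator_def intro!: ennreal_leI)
    qed auto
    then show ?thesis
      by (subst AE_restrict_space_iff) (auto elim!: eventually_mono)
  qed
  have "ennreal (1 - \<epsilon>) \<le> (\<integral>\<^sup>+p. ennreal (case p of (x, y) \<Rightarrow> system_sum N W x y) \<partial>lebesgue_on unit_square)"
  proof -
    let ?f = "\<lambda>(x, y). system_sum N W x y"
    have ge: "1 - \<epsilon> \<le> integral\<^sup>L (lebesgue_on unit_square) ?f"
      using assms(6) by (simp add: full_def)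
    \<comment> \<open>A Bochner integral defaults to 0 on non-integrable functions, so its being at
      least \<open>1 - \<epsilon> > 0\<close> proves integrability.\<close>
    then have "integrable (lebesgue_on unit_square) ?f"
      using assms(2) not_integrable_integral_eq[of "lebesgue_on unit_square" ?f] by force
    then have "(\<integral>\<^sup>+p. ennreal (?f p) \<partial>lebesgue_on unit_square) = ennreal (integral\<^sup>L (lebesgue_on unit_square) ?f)"
      by (intro nn_integral_eq_integral) (auto simp: system_sum_def)
    then show ?thesis using ge by (simp add: ennreal_leI)
  qed
  also have "\<dots> \<le> (\<integral>\<^sup>+p. min 1 (\<Sum>k. ennreal \<delta> * indicator (E k) p) \<partial>lebesgue_on unit_square)"
  proof (rule nn_integral_mono_AE, use W_le in eventually_elim)
    case (elim p)
    obtain x y where p: "p = (x, y)" by (cases p)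
    have "(\<Sum>\<^sub>\<infinity>k\<in>indices N. ennreal (W k x y)) \<le> (\<Sum>k. ennreal \<delta> * indicator (E k) p)"
      unfolding infsum_ennreal_eq_suminf
      using elim p by (intro suminf_le summableI) auto
    moreover have "ennreal (system_sum N W x y) = min 1 (\<Sum>\<^sub>\<infinity>k\<in>indices N. ennreal (W k x y))"
      unfolding system_sum_def by (intro ennreal_enn2real) (simp add: min_less_iff_disj)
    ultimately show ?case unfolding p by (simp only: split_conv min.mono order_refl)
  qed
  \<comment> \<open>With \<open>E k\<close> Borel the integrand is Borel, so the completed measure
    can be replaced by \<open>lborel\<close>.\<close>
  also have "\<dots> = (\<integral>\<^sup>+p. min 1 (\<Sum>k. ennreal \<delta> * indicator (E k) p) * indicator unit_square p \<partial>lborel)"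
    by (subst nn_integral_restrict_space) (auto simp: nn_integral_completion)
  also have "\<dots> = (\<integral>\<^sup>+p. min 1 (\<Sum>k. ennreal \<delta> * indicator (E k) p) \<partial>(U \<Otimes>\<^sub>M U))"
    unfolding UU by (subst nn_integral_density) (auto simp: mult.commute)
  finally have "ennreal (1 - \<epsilon>)
      \<le> (\<integral>\<^sup>+p. min 1 (\<Sum>k. ennreal \<delta> * indicator (A' k \<times> B' k \<union> B' k \<times> A' k) p) \<partial>(U \<Otimes>\<^sub>M U))"
    by (simp only: E_def)
  then have "ennreal (max (2 * (1 - \<epsilon>) / \<delta>)
      (log 2 (1 / \<epsilon>) + of_int \<lfloor>(1 - \<delta>) / (2 * \<delta>)\<rfloor> * log 2 (\<delta> * log 2 (1 / \<epsilon>)) - 1 / \<delta> - 1))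
    \<le> (\<Sum>k. emeasure U (A' k \<union> B' k))"
    using sides assms(1-4) by (intro U.sum_measure_sides_ge) auto
  also have "\<dots> = (\<Sum>k. if k \<in> indices N then emeasure lebesgue (A k \<union> B k) else 0)"
    using sides by (intro suminf_cong) (simp add: emeasure_U)
  finally show ?thesis
    by (simp add: infsum_ennreal_eq_suminf)
qed

end
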